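(* Let $L$ be a complete lattice. The following implications hold: (1) $L\cong\operatorname{Pairs}(\to)$ for some two-acyclic factorization system $(S,\to,\twoheadrightarrow,\hookrightarrow)$ if and only if $L$ is a well separated $\kappa$-lattice. (2) If $L$ is a well separated $\kappa$-lattice then $L$ is a $\kappa$-lattice. (3) If $L\cong\operatorname{Pairs}(\to)$ for some two-acyclic factorization system, then joins and meets in $L$ are cover-determined. (4) If joins and meets in $L$ are cover-determined, then $L$ is weakly atomic. (5) If $L$ is a $\kappa$-lattice then $L$ is bi-spatial. (6) If $L$ is bi-algebraic, then joins and meets in $L$ are cover-determined. (7) If $L$ is bi-algebraic, then $L$ is bi-spatial. Under the additional hypothesis that $L$ is completely semidistributive, the following implications also hold: (8) If joins and meets in $L$ are cover-determined, then $L\cong\operatorname{Pairs}(\to)$ for some two-acyclic factorization system. (9) If $L$ is weakly atomic then $L$ is bi-spatial. (10) If $L$ is bi-spatial then $L$ is a $\kappa$-lattice.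
   Context: Lattices: A complete lattice is a poset in which every subset has a meet and a join. $x\lessdot y$ means $y$ covers $x$. An element $j$ of a complete lattice $L$ is completely join-irreducible if $j=\bigvee X$ implies $j\in X$ for all $X\subseteq L$; equivalently there is $j_*$ such that $x<j$ iff $x\le j_*$. Dually, $m$ is completely meet-irreducible if $m=\bigwedge X$ implies $m\in X$; equivalently there is $m^*$ with $x>m$ iff $x\ge m^*$. $\operatorname{Ji}^cL$, $\operatorname{Mi}^cL$ denote the sets of such elements. $L$ is bi-spatial if every $x\in L$ equals $\bigvee\{j\in\operatorname{Ji}^cL: j\le x\}$ and $\bigwedge\{m\in\operatorname{Mi}^cL: m\ge x\}$. A $\kappa$-lattice is a complete, bi-spatial lattice $L$ for which there are inverse bijections $\kappa:\operatorname{Ji}^cL\to\operatorname{Mi}^cL$ and $\kappa^d:\operatorname{Mi}^cL\to\operatorname{Ji}^cL$ such that $\kappa(j)$ is the maximum element of $\{y: j\wedge y=j_*\}$ and $\kappa^d(m)$ is the minimum element of $\{x: m\vee x=m^*\}$. A $\kappa$-lattice is well separated if whenever $z_1\not\le z_2$, there is $j\in\operatorname{Ji}^cL$ with $z_1\ge j$ and $\kappa(j)\ge z_2$. $L$ is weakly atomic if for all $x<y$ there exist $u,v$ with $x\le u\lessdot v\le y$. Meets in $L$ are cover-determined if whenever $x<y$ and $x\wedge z<y\wedge z$, there is a cover $u\lessdot v$ with $x\le u\lessdot v\le y$ and $u\wedge z<v\wedge z$; joins in $L$ are cover-determined if the dual condition holds (whenever $x<y$ and $x\vee z<y\vee z$,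 there is a cover with $x\le u\lessdot v\le y$ and $u\vee z<v\vee z$). An element $x$ is compact if for every $A\subseteq L$ with $\bigvee A\ge x$ there is a finite $F\subseteq A$ with $\bigvee F\ge x$; $L$ is algebraic if every element is the join of the compact elements below it; $L$ is bi-algebraic if $L$ and its dual are algebraic. A complete lattice is completely join semidistributive if for every nonempty $X\subseteq L$ and $y,z\in L$ with $x\vee y=z$ for all $x\in X$, one has $(\bigwedge X)\vee y=z$; completely meet semidistributive is the dual; completely semidistributive means both. Factorization systems: For a binary relation $\to$ on a set $S$ and $X\subseteq S$, put $X^\perp=\{y\in S: x\not\to y\ \forall x\in X\}$ and ${}^\perp X=\{y\in S: y\not\to x\ \forall x\in X\}$. A maximal orthogonal pair is a pair $(X,Y)$ of subsets of $S$ with $Y=X^\perp$ and $X={}^\perp Y$. $\operatorname{Pairs}(\to)$ is the set of maximal orthogonal pairs, partially ordered by containment of first components. For a reflexive relation $\to$ on $S$, $\operatorname{Fact}(\to)=(\twoheadrightarrow,\hookrightarrow)$, where $x\twoheadrightarrow y$ iff for all $z$, $y\to z$ implies $x\to z$, and $x\hookrightarrow y$ iff for all $z$, $z\to x$ implies $z\to y$. For preorders $\twoheadrightarrow,\hookrightarrow$ on $S$, $\operatorname{Mult}(\twoheadrightarrow,\hookrightarrow)$ is the relation relating $x$ to $z$ iff there is $y\in S$ with $x\twoheadrightarrow y\hookrightarrow z$. A factorization system is a tuple $(S,\to,\twoheadrightarrow,\hookrightarrow)$ ($S$ possibly infinite) with $\to$ reflexive, $\operatorname{Fact}(\to)=(\twoheadrightarrow,\hookrightarrow)$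 and $\operatorname{Mult}(\twoheadrightarrow,\hookrightarrow)=\to$. It is two-acyclic if $x\twoheadrightarrow y\twoheadrightarrow x$ implies $x=y$, $x\hookrightarrow y\hookrightarrow x$ implies $x=y$, and $x\twoheadrightarrow y\hookrightarrow x$ implies $x=y$. *)

theory Defs
  imports Main
begin

text \<open>
  The complete lattice \<open>L\<close> is a type of class \<^class>\<open>complete_lattice\<close>. Properties of \<open>L\<close> as a
  whole are predicates on its type token \<open>TYPE('a)\<close>.
\<close>

section \<open>Complete lattices\<close>

definition covered_by :: "'a::order \<Rightarrow> 'a \<Rightarrow> bool"  (infix \<open>\<lessdot>\<close> 50)
  where "x \<lessdot> y \<longleftrightarrow> x < y \<and> \<not> (\<exists>z. x < z \<and> z < y)"

definition Jic :: "'a::complete_lattice set"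
  where "Jic = {j. \<forall>X. j = Sup X \<longrightarrow> j \<in> X}"

definition Mic :: "'a::complete_lattice set"
  where "Mic = {m. \<forall>X. m = Inf X \<longrightarrow> m \<in> X}"

text \<open>
  The elements \<open>j\<^sub>*\<close> and \<open>m\<^sup>*\<close>. These descriptions are meaningful only for
  \<open>j \<in> Jic\<close> and \<open>m \<in> Mic\<close>, respectively, where existence is guaranteed.
\<close>

definition lower_star :: "'a::complete_lattice \<Rightarrow> 'a"
  where "lower_star j = (THE y. \<forall>x. x < j \<longleftrightarrow> x \<le> y)"

definition upper_star :: "'a::complete_lattice \<Rightarrow> 'a"
  where "upper_star m = (THE y. \<forall>x. m < x \<longleftrightarrow> y \<le> x)"

definition is_maximum :: "'a::order \<Rightarrow> 'a set \<Rightarrow> bool"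
  where "is_maximum a A \<longleftrightarrow> a \<in> A \<and> (\<forall>y\<in>A. y \<le> a)"

definition is_minimum :: "'a::order \<Rightarrow> 'a set \<Rightarrow> bool"
  where "is_minimum a A \<longleftrightarrow> a \<in> A \<and> (\<forall>y\<in>A. a \<le> y)"

definition bi_spatial :: "'a::complete_lattice itself \<Rightarrow> bool"
  where "bi_spatial (_ :: 'a itself) \<longleftrightarrow>
    (\<forall>x::'a. x = Sup {j \<in> Jic. j \<le> x} \<and> x = Inf {m \<in> Mic. x \<le> m})"

text \<open>Only the values of \<open>k\<close> on \<open>Jic\<close> and of \<open>kd\<close> on \<open>Mic\<close> matter; both are determined there.\<close>

definition kappa_maps :: "('a::complete_lattice \<Rightarrow> 'a) \<Rightarrow> ('a \<Rightarrow> 'a) \<Rightarrow> bool"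
  where "kappa_maps k kd \<longleftrightarrow>
    bij_betw k Jic Mic \<and> bij_betw kd Mic Jic \<and>
    (\<forall>j\<in>Jic. kd (k j) = j) \<and> (\<forall>m\<in>Mic. k (kd m) = m) \<and>
    (\<forall>j\<in>Jic. is_maximum (k j) {y. inf j y = lower_star j}) \<and>
    (\<forall>m\<in>Mic. is_minimum (kd m) {x. sup m x = upper_star m})"

definition kappa_lattice :: "'a::complete_lattice itself \<Rightarrow> bool"
  where "kappa_lattice (_ :: 'a itself) \<longleftrightarrow>
    bi_spatial TYPE('a) \<and> (\<exists>k kd :: 'a \<Rightarrow> 'a. kappa_maps k kd)"

definition well_separated_kappa_lattice :: "'a::complete_lattice itself \<Rightarrow> bool"
  where "well_separated_kappa_lattice (_ :: 'a itself) \<longleftrightarrow>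
    bi_spatial TYPE('a) \<and>
    (\<exists>k kd :: 'a \<Rightarrow> 'a. kappa_maps k kd \<and>
      (\<forall>z1 z2. \<not> z1 \<le> z2 \<longrightarrow> (\<exists>j\<in>Jic. j \<le> z1 \<and> z2 \<le> k j)))"

definition weakly_atomic :: "'a::complete_lattice itself \<Rightarrow> bool"
  where "weakly_atomic (_ :: 'a itself) \<longleftrightarrow>
    (\<forall>x y :: 'a. x < y \<longrightarrow> (\<exists>u v. x \<le> u \<and> u \<lessdot> v \<and> v \<le> y))"

definition meets_cover_determined :: "'a::complete_lattice itself \<Rightarrow> bool"
  where "meets_cover_determined (_ :: 'a itself) \<longleftrightarrow>
    (\<forall>x y z :: 'a. x < y \<and> inf x z < inf y z \<longrightarrow>
      (\<exists>u v. x \<le> u \<and> u \<lessdot> v \<and> v \<le> y \<and> inf u z < inf v z))"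

definition joins_cover_determined :: "'a::complete_lattice itself \<Rightarrow> bool"
  where "joins_cover_determined (_ :: 'a itself) \<longleftrightarrow>
    (\<forall>x y z :: 'a. x < y \<and> sup x z < sup y z \<longrightarrow>
      (\<exists>u v. x \<le> u \<and> u \<lessdot> v \<and> v \<le> y \<and> sup u z < sup v z))"

definition compact_element :: "'a::complete_lattice \<Rightarrow> bool"
  where "compact_element x \<longleftrightarrow> (\<forall>A. x \<le> Sup A \<longrightarrow> (\<exists>F\<subseteq>A. finite F \<and> x \<le> Sup F))"

definition cocompact_element :: "'a::complete_lattice \<Rightarrow> bool"
  where "cocompact_element x \<longleftrightarrow> (\<forall>A. Inf A \<le> x \<longrightarrow> (\<exists>F\<subseteq>A. finite F \<and> Inf F \<le> x))"

definition algebraic_lattice :: "'a::complete_lattice itself \<Rightarrow> bool"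
  where "algebraic_lattice (_ :: 'a itself) \<longleftrightarrow>
    (\<forall>x::'a. x = Sup {c. compact_element c \<and> c \<le> x})"

text \<open>The dual of \<open>L\<close> is algebraic.\<close>

definition dually_algebraic_lattice :: "'a::complete_lattice itself \<Rightarrow> bool"
  where "dually_algebraic_lattice (_ :: 'a itself) \<longleftrightarrow>
    (\<forall>x::'a. x = Inf {c. cocompact_element c \<and> x \<le> c})"

definition bi_algebraic :: "'a::complete_lattice itself \<Rightarrow> bool"
  where "bi_algebraic (_ :: 'a itself) \<longleftrightarrow>
    algebraic_lattice TYPE('a) \<and> dually_algebraic_lattice TYPE('a)"

definition completely_join_semidistributive :: "'a::complete_lattice itself \<Rightarrow> bool"
  where "completely_join_semidistributive (_ :: 'a itself) \<longleftrightarrow>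
    (\<forall>(X :: 'a set) y z. X \<noteq> {} \<and> (\<forall>x\<in>X. sup x y = z) \<longrightarrow> sup (Inf X) y = z)"

definition completely_meet_semidistributive :: "'a::complete_lattice itself \<Rightarrow> bool"
  where "completely_meet_semidistributive (_ :: 'a itself) \<longleftrightarrow>
    (\<forall>(X :: 'a set) y z. X \<noteq> {} \<and> (\<forall>x\<in>X. inf x y = z) \<longrightarrow> inf (Sup X) y = z)"

definition completely_semidistributive :: "'a::complete_lattice itself \<Rightarrow> bool"
  where "completely_semidistributive (_ :: 'a itself) \<longleftrightarrow>
    completely_join_semidistributive TYPE('a) \<and> completely_meet_semidistributive TYPE('a)"

section \<open>Factorization systems\<close>

text \<open>
  A relation on the (possibly infinite) set \<open>S\<close> is a subset of \<open>S \<times> S\<close>. The arguments \<open>r\<close>, \<open>e\<close>,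
  \<open>m\<close> stand for the relations \<open>\<rightarrow>\<close>, \<open>\<twoheadrightarrow>\<close>, \<open>\<hookrightarrow>\<close>, in this order.
\<close>

definition right_perp :: "'b set \<Rightarrow> 'b rel \<Rightarrow> 'b set \<Rightarrow> 'b set"
  where "right_perp S r X = {y \<in> S. \<forall>x\<in>X. (x, y) \<notin> r}"

definition left_perp :: "'b set \<Rightarrow> 'b rel \<Rightarrow> 'b set \<Rightarrow> 'b set"
  where "left_perp S r X = {y \<in> S. \<forall>x\<in>X. (y, x) \<notin> r}"

definition Pairs :: "'b set \<Rightarrow> 'b rel \<Rightarrow> ('b set \<times> 'b set) set"
  where "Pairs S r =
    {(X, Y). X \<subseteq> S \<and> Y \<subseteq> S \<and> Y = right_perp S r X \<and> X = left_perp S r Y}"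

definition Fact :: "'b set \<Rightarrow> 'b rel \<Rightarrow> 'b rel \<times> 'b rel"
  where "Fact S r =
    ({(x, y) \<in> S \<times> S. \<forall>z\<in>S. (y, z) \<in> r \<longrightarrow> (x, z) \<in> r},
     {(x, y) \<in> S \<times> S. \<forall>z\<in>S. (z, x) \<in> r \<longrightarrow> (z, y) \<in> r})"

definition Mult :: "'b set \<Rightarrow> 'b rel \<Rightarrow> 'b rel \<Rightarrow> 'b rel"
  where "Mult S e m = {(x, z) \<in> S \<times> S. \<exists>y\<in>S. (x, y) \<in> e \<and> (y, z) \<in> m}"

definition factorization_system :: "'b set \<Rightarrow> 'b rel \<Rightarrow> 'b rel \<Rightarrow> 'b rel \<Rightarrow> bool"
  where "factorization_system S r e m \<longleftrightarrow>
    r \<subseteq> S \<times> S \<and> refl_on S r \<and> Fact S r = (e, m) \<and> Mult S e m = r"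

definition two_acyclic :: "'b rel \<Rightarrow> 'b rel \<Rightarrow> bool"
  where "two_acyclic e m \<longleftrightarrow>
    (\<forall>x y. (x, y) \<in> e \<and> (y, x) \<in> e \<longrightarrow> x = y) \<and>
    (\<forall>x y. (x, y) \<in> m \<and> (y, x) \<in> m \<longrightarrow> x = y) \<and>
    (\<forall>x y. (x, y) \<in> e \<and> (y, x) \<in> m \<longrightarrow> x = y)"

definition isomorphic_to_Pairs :: "'a::complete_lattice itself \<Rightarrow> 'b set \<Rightarrow> 'b rel \<Rightarrow> bool"
  where "isomorphic_to_Pairs (_ :: 'a itself) S r \<longleftrightarrow>
    (\<exists>f :: 'a \<Rightarrow> 'b set \<times> 'b set. bij_betw f UNIV (Pairs S r) \<and>
      (\<forall>x y. x \<le> y \<longleftrightarrow> fst (f x) \<subseteq> fst (f y)))"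

text \<open>
  \<open>L\<close> is isomorphic to the lattice of maximal orthogonal pairs of some two-acyclic factorization
  system whose underlying set consists of elements of \<open>'b\<close>. In a two-acyclic system, the map
  sending \<open>x\<close> to the smallest maximal orthogonal pair whose first component contains \<open>x\<close> is
  injective. Hence the underlying set of any such system can be replaced by a subset of \<open>L\<close>, and
  choosing \<open>'b = 'a\<close> loses no systems up to isomorphism.
\<close>

definition two_acyclic_Pairs_rep :: "'a::complete_lattice itself \<Rightarrow> 'b itself \<Rightarrow> bool"
  where "two_acyclic_Pairs_rep (_ :: 'a itself) (_ :: 'b itself) \<longleftrightarrow>
    (\<exists>(S :: 'b set) r e m. factorization_system S r e m \<and> two_acyclic e m \<and>
      isomorphic_to_Pairs TYPE('a) S r)"

end

theory Submission
  imports Defs "HOL-Library.Dual_Ordered_Lattice"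
begin

text \<open>
  A factorization system gives a family of pairs \<open>(J x, M x)\<close> in \<open>L\<close>: \<open>J x\<close> is the smallest pair
  with \<open>x\<close> in its first component and \<open>M x\<close> the largest pair with \<open>x\<close> in its second one. Factoring
  the arrows shows that the family separates non-inequalities. Together with two-acyclicity this
  makes \<open>J x\<close> completely join-irreducible with \<open>(J x)\<^sub>* = J x \<and> M x\<close>, dually for \<open>M x\<close>, and
  \<open>\<kappa>\<close> sends \<open>J x\<close> to \<open>M x\<close>. Conversely, a well separated \<open>\<kappa>\<close>-lattice is represented by the
  relation \<open>\<not> i \<le> \<kappa> j\<close> on completely join-irreducible elements.

  Cover-determination is obtained from covers of the form \<open>(x \<or> j) \<and> \<kappa> j \<lessdot> x \<or> j\<close>. In a completely
  semidistributive lattice, a cover \<open>u \<lessdot> v\<close> has the completely join-irreducible label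
  \<open>min {t. u \<or> t = v}\<close>, and these labels witness spatiality and well-separation.
\<close>

section \<open>Duality\<close>

text \<open>Statements about \<open>'a dual\<close> are transferred by writing each bound variable
  as a \<open>dual\<close> image and then pulling \<open>dual\<close> outwards. This and the next
  few equivalences are the rewriting rules for it.\<close>

lemma all_dual_iff: "(\<forall>x. P x) \<longleftrightarrow> (\<forall>x. P (dual x))"
  by (metis dual_undual)

lemma ex_dual_iff: "(\<exists>x. P x) \<longleftrightarrow> (\<exists>x. P (dual x))"
  by (metis dual_undual)

lemma dual_image_undual_image: "dual ` undual ` X = X"
  by (simp add: image_comp)

lemma all_dual_set_iff: "(\<forall>X. P X) \<longleftrightarrow> (\<forall>X. P (dual ` X))"
  by (metis dual_image_undual_image)

lemma dual_in_image_iff: "dual x \<in> dual ` A \<longleftrightarrow> x \<in> A"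
  by auto

lemma dual_Collect: "{x. P x} = dual ` {x. P (dual x)}"
  by (auto simp: image_iff) (metis dual_undual)

lemma covered_by_dual_iff: "dual x \<lessdot> dual y \<longleftrightarrow> y \<lessdot> x"
  unfolding covered_by_def by (subst ex_dual_iff) auto

lemma dual_in_Jic_iff: "dual m \<in> Jic \<longleftrightarrow> m \<in> Mic"
  unfolding Jic_def Mic_def
  by (simp, subst all_dual_set_iff)
    (simp add: dual_Inf_eq [symmetric] dual_in_image_iff del: dual_Inf_eq)

lemma dual_in_Mic_iff: "dual j \<in> Mic \<longleftrightarrow> j \<in> Jic"
  unfolding Jic_def Mic_def
  by (simp, subst all_dual_set_iff)
    (simp add: dual_Sup_eq [symmetric] dual_in_image_iff del: dual_Sup_eq)

lemma is_maximum_dual_iff: "is_maximum (dual a) (dual ` A) \<longleftrightarrow> is_minimum a A"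
  by (auto simp: is_maximum_def is_minimum_def)

lemma is_minimum_dual_iff: "is_minimum (dual a) (dual ` A) \<longleftrightarrow> is_maximum a A"
  by (auto simp: is_maximum_def is_minimum_def)

lemma weakly_atomic_dual:
  assumes "weakly_atomic TYPE('a::complete_lattice)"
  shows "weakly_atomic TYPE('a dual)"
  using assms unfolding weakly_atomic_def
  by (subst all_dual_iff, subst all_dual_iff, subst ex_dual_iff, subst ex_dual_iff)
    (simp add: covered_by_dual_iff, blast)

lemma completely_join_semidistributive_dual:
  assumes "completely_meet_semidistributive TYPE('a::complete_lattice)"
  shows "completely_join_semidistributive TYPE('a dual)"
  using assms
  unfolding completely_join_semidistributive_def completely_meet_semidistributive_def
  by (subst all_dual_set_iff, subst all_dual_iff, subst all_dual_iff)
    (simp add: dual_Sup_eq [symmetric] dual_inf_eq [symmetric] del: dual_Sup_eq dual_inf_eq)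

lemma completely_meet_semidistributive_dual:
  assumes "completely_join_semidistributive TYPE('a::complete_lattice)"
  shows "completely_meet_semidistributive TYPE('a dual)"
  using assms
  unfolding completely_join_semidistributive_def completely_meet_semidistributive_def
  by (subst all_dual_set_iff, subst all_dual_iff, subst all_dual_iff)
    (simp add: dual_Inf_eq [symmetric] dual_sup_eq [symmetric] del: dual_Inf_eq dual_sup_eq)

lemma compact_element_dual_iff: "compact_element (dual c) \<longleftrightarrow> cocompact_element c"
proof
  assume c: "compact_element (dual c)"
  show "cocompact_element c"
    unfolding cocompact_element_def
  proof (intro allI impI)
    fix A assume "Inf A \<le> c"
    then have "dual c \<le> Sup (dual ` A)"
      by (simp flip: dual_Inf_eq)
    with c obtain F where "F \<subseteq> dual ` A" "finite F" "dual c \<le> Sup F"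
      unfolding compact_element_def by blast
    moreover from this obtain G where "G \<subseteq> A" "finite G" "F = dual ` G"
      by (meson finite_subset_image)
    ultimately show "\<exists>F\<subseteq>A. finite F \<and> Inf F \<le> c"
      by (metis dual_Inf_eq less_eq_dual_iff)
  qed
next
  assume c: "cocompact_element c"
  show "compact_element (dual c)"
    unfolding compact_element_def
  proof (intro allI impI)
    fix A assume "dual c \<le> Sup A"
    then have "Inf (undual ` A) \<le> c"
      by (simp add: dual_less_eq_iff)
    with c obtain G where "G \<subseteq> undual ` A" "finite G" "Inf G \<le> c"
      unfolding cocompact_element_def by blast
    then have "dual ` G \<subseteq> A" "finite (dual ` G)" "dual c \<le> Sup (dual ` G)"
      by (auto simp flip: dual_Inf_eq)
    then show "\<exists>F\<subseteq>A. finite F \<and> dual c \<le> Sup F"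
      by blast
  qed
qed

lemma algebraic_lattice_dual:
  assumes "dually_algebraic_lattice TYPE('a::complete_lattice)"
  shows "algebraic_lattice TYPE('a dual)"
  using assms unfolding algebraic_lattice_def dually_algebraic_lattice_def
  by (subst all_dual_iff, subst dual_Collect)
    (simp add: compact_element_dual_iff dual_Inf_eq [symmetric] del: dual_Inf_eq)

lemma joins_cover_determined_of_dual:
  assumes "meets_cover_determined TYPE('a::complete_lattice dual)"
  shows "joins_cover_determined TYPE('a)"
  unfolding joins_cover_determined_def
proof (intro allI impI)
  fix x y z :: 'a
  assume "x < y \<and> sup x z < sup y z"
  then have "dual y < dual x \<and> inf (dual y) (dual z) < inf (dual x) (dual z)"
    by (simp flip: dual_sup_eq)
  with assms have "\<exists>u v. dual y \<le> u \<and> u \<lessdot> v \<and> v \<le> dual x \<and> inf u (dual z) < inf v (dual z)"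
    unfolding meets_cover_determined_def by blast
  then show "\<exists>u v. x \<le> u \<and> u \<lessdot> v \<and> v \<le> y \<and> sup u z < sup v z"
    by (subst (asm) ex_dual_iff, subst (asm) ex_dual_iff)
      (simp add: covered_by_dual_iff dual_sup_eq [symmetric] del: dual_sup_eq, blast)
qed

section \<open>Irreducible elements\<close>

text \<open>The join of all elements strictly below an irreducible \<open>j\<close> cannot be
  \<open>j\<close>, for then \<open>j\<close> would be strictly below itself; so this join is the
  largest element below \<open>j\<close>. Conversely, if \<open>j\<close> is missing from
  \<open>X\<close>, all of \<open>X\<close> and hence \<open>Sup X\<close> stays below
  \<open>y < j\<close>.\<close>

lemma Jic_iff: "j \<in> Jic \<longleftrightarrow> (\<exists>y. \<forall>x. x < j \<longleftrightarrow> x \<le> y)"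
proof
  assume j: "j \<in> Jic"
  let ?y = "Sup {x. x < j}"
  have "?y \<noteq> j"
  proof
    assume "?y = j"
    then have "j \<in> {x. x < j}"
      using j unfolding Jic_def by (metis (mono_tags, lifting) mem_Collect_eq)
    then show False
      by simp
  qed
  moreover have "?y \<le> j"
    by (rule Sup_least) auto
  ultimately have "?y < j"
    by simp
  then have "\<forall>x. x < j \<longleftrightarrow> x \<le> ?y"
    by (auto intro: Sup_upper order.strict_trans1)
  then show "\<exists>y. \<forall>x. x < j \<longleftrightarrow> x \<le> y" ..
next
  assume "\<exists>y. \<forall>x. x < j \<longleftrightarrow> x \<le> y"
  then obtain y where y: "\<And>x. x < j \<longleftrightarrow> x \<le> y"
    by blast
  show "j \<in> Jic"
    unfolding Jic_def
  proof (intro CollectI allI impI)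
    fix X assume X: "j = Sup X"
    show "j \<in> X"
    proof (rule ccontr)
      assume "j \<notin> X"
      then have "\<forall>x\<in>X. x < j"
        using X by (metis Sup_upper order.not_eq_order_implies_strict)
      then have "Sup X \<le> y"
        by (simp add: Sup_least y)
      then show False
        using X y by blast
    qed
  qed
qed

lemma lower_star_eqI:
  assumes "\<And>x. x < j \<longleftrightarrow> x \<le> y"
  shows "lower_star j = y"
  unfolding lower_star_def
proof (rule the_equality)
  fix z assume "\<forall>x. x < j \<longleftrightarrow> x \<le> z"
  then show "z = y"
    using assms by (metis order.antisym order.refl)
qed (use assms in blast)

lemma less_Jic_iff: "j \<in> Jic \<Longrightarrow> x < j \<longleftrightarrow> x \<le> lower_star j"
  by (metis Jic_iff lower_star_eqI)

lemma lower_star_less: "j \<in> Jic \<Longrightarrow> lower_star j < j"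
  by (simp add: less_Jic_iff)

text \<open>Existence of \<open>upper_star m\<close> is inherited from the join side through the
  dual order, so the later facts about \<open>Mic\<close> need no proof of their own.\<close>

lemma lower_star_dual:
  assumes "m \<in> Mic"
  shows "lower_star (dual m) = dual (upper_star m)"
proof -
  let ?y = "undual (lower_star (dual m))"
  have less: "m < x \<longleftrightarrow> ?y \<le> x" for x
    using less_Jic_iff [of "dual m" "dual x"] assms
    by (simp add: dual_in_Jic_iff dual_less_eq_iff)
  have "upper_star m = ?y"
    unfolding upper_star_def
    by (rule the_equality) (use less in \<open>auto intro: order.antisym\<close>)
  then show ?thesis
    by simp
qed

lemma less_Mic_iff: "m \<in> Mic \<Longrightarrow> m < x \<longleftrightarrow> upper_star m \<le> x"
  using less_Jic_iff [of "dual m" "dual x"] by (simp add: dual_in_Jic_iff lower_star_dual)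

lemma Mic_iff: "m \<in> Mic \<longleftrightarrow> (\<exists>y. \<forall>x. m < x \<longleftrightarrow> y \<le> x)"
  using Jic_iff [of "dual m"] unfolding dual_in_Jic_iff
  by (subst (asm) ex_dual_iff, subst (asm) all_dual_iff) simp

lemma upper_star_eqI: "(\<And>x. m < x \<longleftrightarrow> y \<le> x) \<Longrightarrow> upper_star m = y"
  by (metis Mic_iff less_Mic_iff order.antisym order.refl)

lemma upper_star_dual:
  assumes "j \<in> Jic"
  shows "upper_star (dual j) = dual (lower_star j)"
proof (rule upper_star_eqI)
  show "dual j < x \<longleftrightarrow> dual (lower_star j) \<le> x" for x
    using less_Jic_iff [OF assms, of "undual x"] by (simp add: dual_less_iff dual_less_eq_iff)
qed

text \<open>The map \<kappa> of the dual lattice is the map \<open>kd\<close> of the original one;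
  this and the next lemma carry results about one map over to the other.\<close>

lemma is_maximum_inf_dual_iff:
  assumes "m \<in> Mic"
  shows "is_maximum (dual j) {y. inf (dual m) y = lower_star (dual m)} \<longleftrightarrow>
    is_minimum j {y. sup m y = upper_star m}"
  by (subst dual_Collect)
    (simp add: assms lower_star_dual is_maximum_dual_iff dual_sup_eq [symmetric] del: dual_sup_eq)

lemma is_minimum_sup_dual_iff:
  assumes "j \<in> Jic"
  shows "is_minimum (dual m) {y. sup (dual j) y = upper_star (dual j)} \<longleftrightarrow>
    is_maximum m {y. inf j y = lower_star j}"
  by (subst dual_Collect)
    (simp add: assms upper_star_dual is_minimum_dual_iff dual_inf_eq [symmetric] del: dual_inf_eq)

lemma is_maximum_unique: "is_maximum a A \<Longrightarrow> is_maximum b A \<Longrightarrow> a = b"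
  by (simp add: is_maximum_def order.antisym)

lemma is_minimum_unique: "is_minimum a A \<Longrightarrow> is_minimum b A \<Longrightarrow> a = b"
  by (simp add: is_minimum_def order.antisym)

text \<open>If \<open>x\<close> is not below \<open>y\<close>, then \<open>y\<close> is no upper
  bound of the irreducibles below \<open>x\<close>. Conversely, separating \<open>x\<close> from the
  join of the irreducibles below it is impossible, so \<open>x\<close> equals that join. Meets are
  treated in the same way.\<close>

lemma bi_spatial_iff_separating:
  "bi_spatial TYPE('a::complete_lattice) \<longleftrightarrow>
    (\<forall>x y :: 'a. \<not> x \<le> y \<longrightarrow>
      (\<exists>j\<in>Jic. j \<le> x \<and> \<not> j \<le> y) \<and> (\<exists>m\<in>Mic. y \<le> m \<and> \<not> x \<le> m))"
  (is "?L \<longleftrightarrow> ?R")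
proof
  assume ?L
  then have sp: "x = Sup {j \<in> Jic. j \<le> x}" "x = Inf {m \<in> Mic. x \<le> m}" for x :: 'a
    unfolding bi_spatial_def by auto
  show ?R
  proof (intro allI impI conjI)
    fix x y :: 'a
    assume "\<not> x \<le> y"
    then show "\<exists>j\<in>Jic. j \<le> x \<and> \<not> j \<le> y" "\<exists>m\<in>Mic. y \<le> m \<and> \<not> x \<le> m"
      using Sup_least [of "{j \<in> Jic. j \<le> x}" y] Inf_greatest [of "{m \<in> Mic. y \<le> m}" x]
        sp(1) [of x] sp(2) [of y] by auto
  qed
next
  assume R: ?R
  show ?L
    unfolding bi_spatial_def
  proof (intro allI conjI)
    fix x :: 'a
    have "x \<le> Sup {j \<in> Jic. j \<le> x}"
      using R by (metis (mono_tags, lifting) Sup_upper mem_Collect_eq)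
    then show "x = Sup {j \<in> Jic. j \<le> x}"
      by (auto intro: order.antisym Sup_least)
    have "Inf {m \<in> Mic. x \<le> m} \<le> x"
      using R by (metis (mono_tags, lifting) Inf_lower mem_Collect_eq)
    then show "x = Inf {m \<in> Mic. x \<le> m}"
      by (auto intro: order.antisym Inf_greatest)
  qed
qed

lemma bi_spatialI:
  assumes "\<And>x y :: 'a::complete_lattice. \<not> x \<le> y \<Longrightarrow> \<exists>j\<in>Jic. j \<le> x \<and> \<not> j \<le> y"
    and "\<And>x y :: 'a dual. \<not> x \<le> y \<Longrightarrow> \<exists>j\<in>Jic. j \<le> x \<and> \<not> j \<le> y"
  shows "bi_spatial TYPE('a)"
  unfolding bi_spatial_iff_separating
proof (intro allI impI conjI)
  fix x y :: 'a
  assume "\<not> x \<le> y"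
  then have "\<exists>j\<in>Jic. j \<le> dual y \<and> \<not> j \<le> dual x"
    using assms(2) [of "dual y" "dual x"] by simp
  then obtain j where "j \<in> Jic" "j \<le> dual y" "\<not> j \<le> dual x"
    by blast
  then have "undual j \<in> Mic" "y \<le> undual j" "\<not> x \<le> undual j"
    using dual_in_Jic_iff [of "undual j"] by (simp_all add: dual_less_eq_iff)
  then show "\<exists>m\<in>Mic. y \<le> m \<and> \<not> x \<le> m"
    by blast
qed (use assms(1) in blast)

section \<open>Separating families\<close>

text \<open>The traces in the lattice of a two-acyclic factorization system: \<open>not_le\<close>
  comes from reflexivity, \<open>separating\<close> from the factorization of arrows,
  \<open>inj_J\<close> and \<open>inj_M\<close> from antisymmetry of the two preorders,
  \<open>acyclic\<close> from the mixed acyclicity condition.\<close>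

locale separating_family =
  fixes S :: "'b set" and J M :: "'b \<Rightarrow> 'a::complete_lattice"
  assumes separating: "\<not> a \<le> b \<Longrightarrow> \<exists>w\<in>S. J w \<le> a \<and> b \<le> M w"
    and not_le: "x \<in> S \<Longrightarrow> \<not> J x \<le> M x"
    and acyclic: "x \<in> S \<Longrightarrow> y \<in> S \<Longrightarrow> J y \<le> J x \<Longrightarrow> M x \<le> M y \<Longrightarrow> y = x"
    and inj_J: "inj_on J S"
    and inj_M: "inj_on M S"
begin

text \<open>The conditions are symmetric under reversing the order and exchanging \<open>J\<close>
  with \<open>M\<close>, so each result on \<open>J\<close> yields one on \<open>M\<close>.\<close>

lemma dual_family: "separating_family S (\<lambda>x. dual (M x)) (\<lambda>x. dual (J x))"
proof
  fix a b :: "'a dual"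
  assume "\<not> a \<le> b"
  then show "\<exists>w\<in>S. dual (M w) \<le> a \<and> b \<le> dual (J w)"
    using separating [of "undual b" "undual a"] by (auto simp: dual_less_eq_iff)
qed (auto simp: not_le inj_on_def intro: acyclic dest: inj_onD [OF inj_J] inj_onD [OF inj_M])

text \<open>If \<open>y < J x\<close> were not below \<open>M x\<close>, separation would give
  \<open>w\<close> with \<open>J w \<le> y\<close> and \<open>M x \<le> M w\<close>. Acyclicity then
  forces \<open>w = x\<close>, contradicting \<open>J w < J x\<close>.\<close>

lemma less_J_iff:
  assumes "x \<in> S"
  shows "y < J x \<longleftrightarrow> y \<le> inf (J x) (M x)"
proof
  assume "y < J x"
  moreover have "y \<le> M x"
    using separating [of y "M x"] acyclic [of x] assms \<open>y < J x\<close>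
    by (metis order.strict_trans2 order.strict_implies_order order.irrefl order.strict_trans1)
  ultimately show "y \<le> inf (J x) (M x)"
    by simp
next
  assume "y \<le> inf (J x) (M x)"
  then show "y < J x"
    using not_le [OF assms] by (metis le_inf_iff order.not_eq_order_implies_strict)
qed

lemma J_in_Jic: "x \<in> S \<Longrightarrow> J x \<in> Jic"
  using less_J_iff unfolding Jic_iff by blast

lemma lower_star_J: "x \<in> S \<Longrightarrow> lower_star (J x) = inf (J x) (M x)"
  by (simp add: less_J_iff lower_star_eqI)

lemma spatial:
  fixes a b :: 'a
  shows "\<not> a \<le> b \<Longrightarrow> \<exists>j\<in>Jic. j \<le> a \<and> \<not> j \<le> b"
  using separating [of a b] not_le J_in_Jic by (meson order.trans)

text \<open>Separate \<open>j\<close> from \<open>lower_star j\<close> by an index \<open>w\<close>.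
  Were \<open>J w\<close> strictly below \<open>j\<close>, it would lie below
  \<open>lower_star j\<close> and so below \<open>M w\<close>; hence \<open>J w = j\<close>.\<close>

lemma Jic_eq: "Jic = J ` S"
proof
  show "J ` S \<subseteq> Jic"
    using J_in_Jic by blast
  show "Jic \<subseteq> J ` S"
  proof
    fix j :: 'a
    assume j: "j \<in> Jic"
    then obtain w where w: "w \<in> S" "J w \<le> j" "lower_star j \<le> M w"
      using separating [of j "lower_star j"] lower_star_less less_le_not_le by blast
    have "\<not> J w < j"
      using w not_le j by (meson less_Jic_iff order.trans)
    then show "j \<in> J ` S"
      using w by (auto simp: order.not_eq_order_implies_strict)
  qed
qed

text \<open>For \<open>y\<close> not below \<open>M x\<close>, separation gives \<open>u\<close>
  with \<open>J u \<le> y\<close> and \<open>M x \<le> M u\<close>, and \<open>v\<close> with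
  \<open>J v \<le> J x\<close> and \<open>y \<le> M v\<close>. If \<open>v\<close> differs from
  \<open>x\<close>, then \<open>J v\<close> lies below the meet of \<open>J x\<close> and
  \<open>M x\<close>, hence below \<open>y\<close> and \<open>M v\<close>. If \<open>v = x\<close>,
  then \<open>J u \<le> y \<le> M x \<le> M u\<close>. Both contradict
  \<open>not_le\<close>.\<close>

lemma M_is_maximum:
  assumes x: "x \<in> S"
  shows "is_maximum (M x) {y. inf (J x) y = lower_star (J x)}"
proof -
  have "y \<le> M x" if y: "inf (J x) y = inf (J x) (M x)" for y
  proof (rule ccontr)
    assume "\<not> y \<le> M x"
    then obtain u where u: "u \<in> S" "J u \<le> y" "M x \<le> M u"
      using separating by blast
    have "\<not> J x \<le> y"
      using y not_le [OF x] by (metis inf.absorb_iff1)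
    then obtain v where v: "v \<in> S" "J v \<le> J x" "y \<le> M v"
      using separating by blast
    have "v = x"
    proof (rule ccontr)
      assume "v \<noteq> x"
      then have "J v < J x"
        using v x inj_onD [OF inj_J] by (metis order.not_eq_order_implies_strict)
      then have "J v \<le> inf (J x) (M x)"
        using less_J_iff x by blast
      then have "J v \<le> y"
        using y by (metis le_inf_iff)
      then show False
        using v not_le order.trans by blast
    qed
    then show False
      using u v not_le by (meson order.trans)
  qed
  then show ?thesis
    using x by (auto simp: is_maximum_def lower_star_J)
qed

lemma Mic_eq: "Mic = M ` S"
proof -
  have "m \<in> Mic \<longleftrightarrow> dual m \<in> (\<lambda>x. dual (M x)) ` S" for m :: 'a
    using separating_family.Jic_eq [OF dual_family] dual_in_Jic_iff by metis
  then show ?thesis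
    by auto
qed

lemma J_is_minimum:
  assumes "x \<in> S"
  shows "is_minimum (J x) {y. sup (M x) y = upper_star (M x)}"
  using separating_family.M_is_maximum [OF dual_family assms] assms
  by (simp add: is_maximum_inf_dual_iff Mic_eq)

lemma well_separated_kappa_lattice: "well_separated_kappa_lattice TYPE('a)"
proof -
  \<comment> \<open>As \<open>J\<close> and \<open>M\<close> are injective on \<open>S\<close> with
    ranges \<open>Jic\<close> and \<open>Mic\<close>, both maps just pass through the common
    index.\<close>
  let ?k = "\<lambda>j. M (inv_into S J j)" and ?kd = "\<lambda>m. J (inv_into S M m)"
  have k: "?k (J x) = M x" and kd: "?kd (M x) = J x" if "x \<in> S" for x
    using that inj_J inj_M by simp_all
  have "kappa_maps ?k ?kd"
    unfolding kappa_maps_def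
  proof (intro conjI)
    show inverse: "\<forall>j\<in>Jic. ?kd (?k j) = j" "\<forall>m\<in>Mic. ?k (?kd m) = m"
      unfolding Jic_eq Mic_eq by (metis (no_types, lifting) imageE k kd)+
    show "\<forall>j\<in>Jic. is_maximum (?k j) {y. inf j y = lower_star j}"
      unfolding Jic_eq by (auto simp: k M_is_maximum)
    show "\<forall>m\<in>Mic. is_minimum (?kd m) {y. sup m y = upper_star m}"
      unfolding Mic_eq by (auto simp: kd J_is_minimum)
    have maps: "?k ` Jic \<subseteq> Mic" "?kd ` Mic \<subseteq> Jic"
      unfolding Jic_eq Mic_eq using k kd by auto
    show "bij_betw ?k Jic Mic"
      by (rule bij_betw_byWitness [OF inverse maps])
    show "bij_betw ?kd Mic Jic"
      by (rule bij_betw_byWitness [OF inverse(2,1) maps(2,1)])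
  qed
  moreover have "\<exists>j\<in>Jic. j \<le> a \<and> b \<le> ?k j" if ab: "\<not> a \<le> b" for a b
  proof -
    obtain w where "w \<in> S" "J w \<le> a" "b \<le> M w"
      using separating [OF ab] by blast
    then show ?thesis
      using k J_in_Jic by (metis (no_types, lifting))
  qed
  moreover have "bi_spatial TYPE('a)"
    using spatial separating_family.spatial [OF dual_family] by (rule bi_spatialI)
  ultimately show ?thesis
    unfolding well_separated_kappa_lattice_def by blast
qed

end

section \<open>Factorization systems\<close>

text \<open>The two perps form a Galois connection, so closing a subset on either side gives a
  maximal orthogonal pair.\<close>

lemma Pairs_of_right_perp:
  "X \<subseteq> S \<Longrightarrow> (left_perp S r (right_perp S r X), right_perp S r X) \<in> Pairs S r"
  unfolding Pairs_def left_perp_def right_perp_def by blast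

lemma Pairs_of_left_perp:
  "Y \<subseteq> S \<Longrightarrow> (left_perp S r Y, right_perp S r (left_perp S r Y)) \<in> Pairs S r"
  unfolding Pairs_def left_perp_def right_perp_def by blast

lemma separating_family_of_Pairs:
  fixes S :: "'b set" and f :: "'a::complete_lattice \<Rightarrow> 'b set \<times> 'b set"
  assumes fs: "factorization_system S r e m" and ac: "two_acyclic e m"
    and bij: "bij_betw f UNIV (Pairs S r)"
    and le: "\<And>x y. x \<le> y \<longleftrightarrow> fst (f x) \<subseteq> fst (f y)"
  shows "\<exists>J M :: 'b \<Rightarrow> 'a. separating_family S J M"
proof -
  \<comment> \<open>The pairs generated by \<open>{x}\<close> in the first and in the second
    component, pulled back along the bijection \<open>f\<close>.\<close>
  define J where "J x = inv f (left_perp S r (right_perp S r {x}), right_perp S r {x})" for x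
  define M where "M x = inv f (left_perp S r {x}, right_perp S r (left_perp S r {x}))" for x
  have f_inv: "f (inv f p) = p" if "p \<in> Pairs S r" for p
    using bij that by (metis bij_betw_inv_into_right)
  have fJ: "f (J x) = (left_perp S r (right_perp S r {x}), right_perp S r {x})"
    and fM: "f (M x) = (left_perp S r {x}, right_perp S r (left_perp S r {x}))"
    if "x \<in> S" for x
    using that unfolding J_def M_def
    by (simp_all add: f_inv Pairs_of_right_perp Pairs_of_left_perp)
  have "f l \<in> Pairs S r" for l
    using bij bij_betwE by blast
  then have sub: "fst (f l) \<subseteq> S" "snd (f l) \<subseteq> S"
    and snd: "snd (f l) = right_perp S r (fst (f l))"
    and fst: "fst (f l) = left_perp S r (snd (f l))" for l
    unfolding Pairs_def by (metis (mono_tags, lifting) case_prodD mem_Collect_eq prod.collapse)+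
  have J_le: "J x \<le> l \<longleftrightarrow> x \<in> fst (f l)" if x: "x \<in> S" for x l
  proof
    assume "J x \<le> l"
    then have "left_perp S r (right_perp S r {x}) \<subseteq> fst (f l)"
      using le [of "J x" l] x by (simp add: fJ)
    moreover have "x \<in> left_perp S r (right_perp S r {x})"
      using x unfolding left_perp_def right_perp_def by blast
    ultimately show "x \<in> fst (f l)"
      by blast
  next
    assume "x \<in> fst (f l)"
    then have "snd (f l) \<subseteq> right_perp S r {x}"
      unfolding snd right_perp_def by blast
    then have "left_perp S r (right_perp S r {x}) \<subseteq> fst (f l)"
      unfolding fst [of l] left_perp_def by blast
    then show "J x \<le> l"
      using le x by (simp add: fJ)
  qed
  have le_M: "l \<le> M x \<longleftrightarrow> x \<in> snd (f l)" if x: "x \<in> S" for x l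
  proof -
    have "l \<le> M x \<longleftrightarrow> fst (f l) \<subseteq> left_perp S r {x}"
      using le x by (simp add: fM)
    also have "\<dots> \<longleftrightarrow> x \<in> snd (f l)"
      using x sub(1) [of l] unfolding snd left_perp_def right_perp_def by blast
    finally show ?thesis .
  qed
  have refl: "(x, x) \<in> r" if "x \<in> S" for x
    using fs that unfolding factorization_system_def by (auto dest: refl_onD)
  have e: "e = {(x, y) \<in> S \<times> S. \<forall>z\<in>S. (y, z) \<in> r \<longrightarrow> (x, z) \<in> r}"
    and m: "m = {(x, y) \<in> S \<times> S. \<forall>z\<in>S. (z, x) \<in> r \<longrightarrow> (z, y) \<in> r}"
    and r: "r = {(x, z) \<in> S \<times> S. \<exists>y\<in>S. (x, y) \<in> e \<and> (y, z) \<in> m}"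
    using fs unfolding factorization_system_def Fact_def Mult_def by auto
  \<comment> \<open>This equivalence and \<open>M_le_M\<close> turn two-acyclicity of
    \<open>e\<close> and \<open>m\<close> into \<open>acyclic\<close>, \<open>inj_J\<close> and
    \<open>inj_M\<close>.\<close>
  have J_le_J: "J y \<le> J x \<longleftrightarrow> (x, y) \<in> e" if "x \<in> S" "y \<in> S" for x y
    using that unfolding J_le [OF that(2)] fJ [OF that(1)] e
    by (auto simp: left_perp_def right_perp_def)
  have M_le_M: "M x \<le> M y \<longleftrightarrow> (y, x) \<in> m" if "x \<in> S" "y \<in> S" for x y
    using that unfolding le_M [OF that(2)] fM [OF that(1)] m
    by (auto simp: left_perp_def right_perp_def)
  have "separating_family S J M"
  proof
    fix a b :: 'a
    assume "\<not> a \<le> b"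
    \<comment> \<open>Since the pair of \<open>b\<close> is closed, \<open>x\<close> has an arrow to
      some \<open>z\<close> in its second component. The middle point \<open>w\<close> of a
      factorization of this arrow works: first components are closed under \<open>e\<close>, and
      second components are closed under \<open>m\<close> read backwards.\<close>
    then obtain x where x: "x \<in> fst (f a)" "x \<notin> fst (f b)"
      using le by blast
    then obtain z where z: "z \<in> snd (f b)" "(x, z) \<in> r"
      using sub(1) [of a] unfolding fst [of b] left_perp_def by blast
    then obtain w where w: "w \<in> S" "(x, w) \<in> e" "(w, z) \<in> m"
      using r by blast
    have "w \<in> fst (f a)"
      using x w sub(2) [of a] unfolding fst [of a] left_perp_def e by blast
    moreover have "w \<in> snd (f b)"
      using z w sub(1) [of b] unfolding snd [of b] right_perp_def m by blast
    ultimately show "\<exists>w\<in>S. J w \<le> a \<and> b \<le> M w"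
      using w J_le le_M by blast
  next
    show "\<not> J x \<le> M x" if "x \<in> S" for x
      using that refl by (simp add: le_M fJ right_perp_def)
  next
    show "y = x" if "x \<in> S" "y \<in> S" "J y \<le> J x" "M x \<le> M y" for x y
      using that ac unfolding two_acyclic_def by (metis J_le_J M_le_M)
  next
    show "inj_on J S"
      using ac unfolding two_acyclic_def by (metis J_le_J inj_onI order.refl)
    show "inj_on M S"
      using ac unfolding two_acyclic_def by (metis M_le_M inj_onI order.refl)
  qed
  then show ?thesis
    by blast
qed

lemma well_separated_of_Pairs_rep:
  assumes "two_acyclic_Pairs_rep TYPE('a::complete_lattice) TYPE('b)"
  shows "well_separated_kappa_lattice TYPE('a)"
  using assms unfolding two_acyclic_Pairs_rep_def isomorphic_to_Pairs_def
  by (meson separating_family_of_Pairs separating_family.well_separated_kappa_lattice)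

section \<open>From well separated \<kappa>-lattices to factorization systems\<close>

lemma kappa_not_le:
  assumes "kappa_maps k kd" and "j \<in> Jic"
  shows "\<not> j \<le> k j"
  using assms lower_star_less [OF assms(2)]
  by (auto simp: kappa_maps_def is_maximum_def inf.absorb1)

text \<open>Meeting with \<open>j\<close> is monotone, so the set with maximum \<open>k j\<close> is
  the whole interval from \<open>lower_star j\<close> to \<open>k j\<close>.\<close>

lemma le_kappa_iff:
  assumes "kappa_maps k kd" and j: "j \<in> Jic"
  shows "y \<le> k j \<and> lower_star j \<le> y \<longleftrightarrow> inf j y = lower_star j"
proof -
  have k: "inf j (k j) = lower_star j" "\<And>y. inf j y = lower_star j \<Longrightarrow> y \<le> k j"
    using assms unfolding kappa_maps_def is_maximum_def by auto
  show ?thesis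
  proof
    assume y: "y \<le> k j \<and> lower_star j \<le> y"
    then have "inf j y \<le> lower_star j"
      using k(1) by (metis inf_mono order.refl)
    then show "inf j y = lower_star j"
      using y lower_star_less [OF j] by (simp add: order.antisym)
  next
    assume "inf j y = lower_star j"
    then show "y \<le> k j \<and> lower_star j \<le> y"
      using k(2) by (metis inf_le2)
  qed
qed

lemma Pairs_rep_of_well_separated:
  assumes "well_separated_kappa_lattice TYPE('a::complete_lattice)"
  shows "two_acyclic_Pairs_rep TYPE('a) TYPE('a)"
proof -
  from assms obtain k kd :: "'a \<Rightarrow> 'a" where sp: "bi_spatial TYPE('a)"
    and km: "kappa_maps k kd"
    and ws: "\<And>a b. \<not> a \<le> b \<Longrightarrow> \<exists>j\<in>Jic. j \<le> a \<and> b \<le> k j"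
    unfolding well_separated_kappa_lattice_def by blast
  define r where "r = {(i, j) \<in> Jic \<times> Jic. \<not> i \<le> k j}"
  define e where "e = {(i, j) \<in> Jic \<times> (Jic :: 'a set). j \<le> i}"
  define m where "m = {(i, j) \<in> Jic \<times> Jic. k j \<le> k i}"
  define f where "f x = ({j \<in> Jic. j \<le> x}, {j \<in> Jic. x \<le> k j})" for x
  have not_le: "\<not> j \<le> k j" if "j \<in> Jic" for j
    using kappa_not_le km that by blast
  have bij: "bij_betw k Jic Mic"
    using km unfolding kappa_maps_def by blast
  have le_iff_J: "a \<le> b \<longleftrightarrow> (\<forall>j\<in>Jic. j \<le> a \<longrightarrow> j \<le> b)" for a b :: 'a
    using sp unfolding bi_spatial_iff_separating by (meson order.trans)
  have "a \<le> b \<longleftrightarrow> (\<forall>m\<in>Mic. b \<le> m \<longrightarrow> a \<le> m)" for a b :: 'a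
    using sp unfolding bi_spatial_iff_separating by (meson order.trans)
  \<comment> \<open>Meet-spatiality, rephrased through surjectivity of \<open>k\<close> onto
    \<open>Mic\<close>.\<close>
  then have le_iff_M: "a \<le> b \<longleftrightarrow> (\<forall>j\<in>Jic. b \<le> k j \<longrightarrow> a \<le> k j)" for a b
    using bij_betw_imp_surj_on [OF bij] by (metis (no_types, lifting) imageE imageI)
  have "Fact Jic r = (e, m)"
  proof -
    have "(\<forall>z\<in>Jic. \<not> y \<le> k z \<longrightarrow> \<not> x \<le> k z) \<longleftrightarrow> y \<le> x" for x y
      using le_iff_M [of y x] by blast
    moreover have "(\<forall>z\<in>Jic. \<not> z \<le> k x \<longrightarrow> \<not> z \<le> k y) \<longleftrightarrow> k y \<le> k x" for x y
      using le_iff_J [of "k y" "k x"] by blast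
    ultimately show ?thesis
      unfolding Fact_def r_def e_def m_def by auto
  qed
  moreover have "Mult Jic e m = r"
  proof -
    \<comment> \<open>Factoring the arrow from \<open>i\<close> to \<open>l\<close> is
      well-separation applied to \<open>i\<close> and \<open>k l\<close>.\<close>
    have "(\<exists>j\<in>Jic. j \<le> i \<and> k l \<le> k j) \<longleftrightarrow> \<not> i \<le> k l" for i l
      using ws not_le by (meson order.trans)
    then show ?thesis
      unfolding Mult_def r_def e_def m_def by auto
  qed
  moreover have "r \<subseteq> Jic \<times> Jic" "refl_on Jic r"
    using not_le unfolding r_def by (auto intro: refl_onI)
  ultimately have "factorization_system Jic r e m"
    unfolding factorization_system_def by blast
  moreover have "two_acyclic e m"
  proof -
    have "x = y" if x: "x \<in> Jic" and y: "y \<in> Jic" and "y \<le> x" "k x \<le> k y" for x y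
    proof (rule ccontr)
      assume "x \<noteq> y"
      then have "y < x"
        using \<open>y \<le> x\<close> by simp
      then have "y \<le> lower_star x"
        using less_Jic_iff x by blast
      also have "\<dots> \<le> k x"
        using km x unfolding kappa_maps_def is_maximum_def
        by (metis (mono_tags, lifting) inf_le2 mem_Collect_eq)
      also have "\<dots> \<le> k y"
        by fact
      finally show False
        using not_le y by blast
    qed
    moreover have "inj_on k Jic"
      using bij by (rule bij_betw_imp_inj_on)
    ultimately show ?thesis
      unfolding two_acyclic_def e_def m_def by (auto intro: order.antisym dest: inj_onD)
  qed
  moreover have "bij_betw f UNIV (Pairs Jic r)"
    unfolding bij_betw_def
  proof
    show "inj f"
    proof (rule injI)
      fix x y
      assume "f x = f y"
      then have "{j \<in> Jic. j \<le> x} = {j \<in> Jic. j \<le> y}"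
        unfolding f_def by simp
      then show "x = y"
        using le_iff_J [of x y] le_iff_J [of y x] by (blast intro: order.antisym)
    qed
    show "range f = Pairs Jic r"
    proof
      show "range f \<subseteq> Pairs Jic r"
      proof
        fix p assume "p \<in> range f"
        then obtain x where p: "p = f x"
          by blast
        have "{j \<in> Jic. x \<le> k j} = {j \<in> Jic. \<forall>i\<in>Jic. i \<le> x \<longrightarrow> i \<le> k j}"
          using le_iff_J [of x] by blast
        moreover have "{i \<in> Jic. i \<le> x} = {i \<in> Jic. \<forall>j\<in>Jic. x \<le> k j \<longrightarrow> i \<le> k j}"
          using le_iff_M [of _ x] by blast
        ultimately show "p \<in> Pairs Jic r"
          unfolding p f_def Pairs_def right_perp_def left_perp_def r_def by auto
      qed
      show "Pairs Jic r \<subseteq> range f"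
      proof
        fix p assume "p \<in> Pairs Jic r"
        then obtain X Y where p: "p = (X, Y)" and "X \<subseteq> Jic"
          and Y: "Y = right_perp Jic r X" and X: "X = left_perp Jic r Y"
          unfolding Pairs_def by blast
        \<comment> \<open>The preimage of a pair is the join of its first component.\<close>
        have "Y = {j \<in> Jic. Sup X \<le> k j}"
          unfolding Y right_perp_def r_def using \<open>X \<subseteq> Jic\<close> by (auto simp: Sup_le_iff)
        moreover from this have "X = {i \<in> Jic. i \<le> Sup X}"
          by (subst X) (auto simp: left_perp_def r_def le_iff_M [of _ "Sup X"])
        ultimately show "p \<in> range f"
          unfolding p f_def by blast
      qed
    qed
  qed
  moreover have "x \<le> y \<longleftrightarrow> fst (f x) \<subseteq> fst (f y)" for x y
    unfolding f_def using le_iff_J [of x y] by auto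
  ultimately show ?thesis
    unfolding two_acyclic_Pairs_rep_def isomorphic_to_Pairs_def by blast
qed

section \<open>Cover-determined joins and meets\<close>

text \<open>An element \<open>t\<close> above the meet, at most \<open>sup x j\<close> and different
  from the meet is not below \<open>k j\<close>, yet it is above \<open>lower_star j\<close>. So it
  meets \<open>j\<close> in more than \<open>lower_star j\<close>, that is,
  \<open>j \<le> t\<close>; as also \<open>x \<le> t\<close>, it is the top of the interval.\<close>

lemma kappa_cover:
  assumes km: "kappa_maps k kd" and j: "j \<in> Jic" and "x \<le> k j"
  shows "x \<le> inf (sup x j) (k j)" and "inf (sup x j) (k j) \<lessdot> sup x j"
proof -
  let ?v = "sup x j"
  let ?u = "inf ?v (k j)"
  show "x \<le> ?u"
    using assms by simp
  have star: "lower_star j \<le> k j" "lower_star j \<le> j"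
    using le_kappa_iff [OF km j] km j lower_star_less [OF j]
    unfolding kappa_maps_def is_maximum_def by auto
  have "?u \<noteq> ?v"
    using kappa_not_le [OF km j] by (metis inf_le2 le_sup_iff)
  moreover have "t = ?v" if "?u < t" "t \<le> ?v" for t
  proof -
    have "\<not> t \<le> k j"
      using that by (metis le_inf_iff less_le_not_le)
    moreover have "lower_star j \<le> t"
      using star that by (meson le_inf_iff le_supI2 order.trans order.strict_implies_order)
    ultimately have "inf j t \<noteq> lower_star j" "lower_star j \<le> inf j t"
      using le_kappa_iff [OF km j, of t] star by auto
    then have "\<not> inf j t < j"
      using less_Jic_iff [OF j] by (metis order.antisym)
    then have "j \<le> t"
      by (metis inf_le1 inf_le2 order.not_eq_order_implies_strict)
    moreover have "x \<le> t"
      using \<open>x \<le> ?u\<close> that by (meson order.trans order.strict_implies_order)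
    ultimately show "t = ?v"
      using that by (simp add: order.antisym)
  qed
  ultimately show "?u \<lessdot> ?v"
    unfolding covered_by_def
    by (metis inf_le1 less_le_not_le order.not_eq_order_implies_strict)
qed

text \<open>The cover is that of \<open>kappa_cover\<close>. For joins, \<open>j\<close> separates
  \<open>y\<close> from \<open>sup x z\<close>, and \<open>k j\<close> bounds \<open>sup u z\<close>
  but not \<open>sup v z\<close>. For meets, \<open>j\<close> separates \<open>inf y z\<close> from
  \<open>x\<close>, and \<open>j\<close> lies below \<open>inf v z\<close> but not below
  \<open>inf u z\<close>.\<close>

lemma cover_determined_of_well_separated:
  assumes "well_separated_kappa_lattice TYPE('a::complete_lattice)"
  shows "joins_cover_determined TYPE('a)" and "meets_cover_determined TYPE('a)"
proof -
  from assms obtain k kd :: "'a \<Rightarrow> 'a" where km: "kappa_maps k kd"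
    and ws: "\<And>a b. \<not> a \<le> b \<Longrightarrow> \<exists>j\<in>Jic. j \<le> a \<and> b \<le> k j"
    unfolding well_separated_kappa_lattice_def by blast
  show "joins_cover_determined TYPE('a)"
    unfolding joins_cover_determined_def
  proof (intro allI impI)
    fix x y z :: 'a
    assume xyz: "x < y \<and> sup x z < sup y z"
    then have "\<not> y \<le> sup x z"
      by (metis le_sup_iff less_le_not_le sup_ge2)
    then obtain j where j: "j \<in> Jic" "j \<le> y" "x \<le> k j" "z \<le> k j"
      using ws by (metis le_sup_iff)
    let ?v = "sup x j"
    let ?u = "inf ?v (k j)"
    have "sup ?u z \<le> k j"
      using j by (simp add: le_infI2)
    moreover have "\<not> sup ?v z \<le> k j"
      using kappa_not_le [OF km j(1)] by simp
    moreover have "sup ?u z \<le> sup ?v z"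
      by (simp add: le_supI1)
    ultimately have "sup ?u z < sup ?v z"
      by (metis order.not_eq_order_implies_strict)
    moreover have "?v \<le> y"
      using j xyz by (simp add: order.strict_implies_order)
    ultimately show "\<exists>u v. x \<le> u \<and> u \<lessdot> v \<and> v \<le> y \<and> sup u z < sup v z"
      using kappa_cover [OF km j(1,3)] by blast
  qed
  show "meets_cover_determined TYPE('a)"
    unfolding meets_cover_determined_def
  proof (intro allI impI)
    fix x y z :: 'a
    assume xyz: "x < y \<and> inf x z < inf y z"
    then have "\<not> inf y z \<le> x"
      by (metis inf_le2 le_inf_iff less_le_not_le)
    then obtain j where j: "j \<in> Jic" "j \<le> y" "j \<le> z" "x \<le> k j"
      using ws by (metis le_inf_iff)
    let ?v = "sup x j"
    let ?u = "inf ?v (k j)"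
    have "\<not> j \<le> inf ?u z" "j \<le> inf ?v z"
      using j kappa_not_le [OF km j(1)] by auto
    moreover have "inf ?u z \<le> inf ?v z"
      by (simp add: le_infI1)
    ultimately have "inf ?u z < inf ?v z"
      by (metis order.not_eq_order_implies_strict)
    moreover have "?v \<le> y"
      using j xyz by (simp add: order.strict_implies_order)
    ultimately show "\<exists>u v. x \<le> u \<and> u \<lessdot> v \<and> v \<le> y \<and> inf u z < inf v z"
      using kappa_cover [OF km j(1,4)] by blast
  qed
qed

lemma weakly_atomic_of_joins_cover_determined:
  assumes "joins_cover_determined TYPE('a::complete_lattice)"
  shows "weakly_atomic TYPE('a)"
  unfolding weakly_atomic_def
proof (intro allI impI)
  fix x y :: 'a
  assume "x < y"
  then have "x < y \<and> sup x bot < sup y bot"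
    by simp
  with assms show "\<exists>u v. x \<le> u \<and> u \<lessdot> v \<and> v \<le> y"
    unfolding joins_cover_determined_def by blast
qed

section \<open>Algebraic lattices\<close>

lemma finite_chain_upper_bound:
  fixes C :: "'a::complete_lattice set"
  assumes "finite F" and "F \<subseteq> C" and "C \<noteq> {}"
    and "\<And>a b. a \<in> C \<Longrightarrow> b \<in> C \<Longrightarrow> a \<le> b \<or> b \<le> a"
  shows "\<exists>w\<in>C. Sup F \<le> w"
  using assms(1,2)
proof (induction F)
  case empty
  then show ?case
    using assms(3) by auto
next
  case (insert a F)
  then obtain w where "w \<in> C" "Sup F \<le> w"
    by blast
  then show ?case
    using assms(4) [of a w] insert.prems
    by (metis Sup_insert insert_subset le_sup_iff order.refl order.trans)
qed

text \<open>Zorn's lemma in the interval from \<open>x\<close> to \<open>y\<close>: if the join of a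
  chain is above \<open>c\<close>, compactness gives a finite subset with join above
  \<open>c\<close>, and so a single member above \<open>c\<close>.\<close>

lemma maximal_not_above_compact:
  fixes c :: "'a::complete_lattice"
  assumes c: "compact_element c" and xy: "x \<le> y" and cx: "\<not> c \<le> x"
  obtains u where "x \<le> u" "u \<le> y" "\<not> c \<le> u" "\<And>t. u < t \<Longrightarrow> t \<le> y \<Longrightarrow> c \<le> t"
proof -
  define A where "A = {u. x \<le> u \<and> u \<le> y \<and> \<not> c \<le> u}"
  have "x \<in> A"
    using xy cx unfolding A_def by simp
  have "\<exists>u\<in>A. \<forall>a\<in>A. u \<le> a \<longrightarrow> a = u"
  proof (rule predicate_Zorn)
    show "partial_order_on A (relation_of (\<le>) A)"
      by (rule partial_order_on_relation_ofI) auto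
  next
    fix C assume "C \<in> Chains (relation_of (\<le>) A)"
    then have CA: "C \<subseteq> A" and chain: "\<And>a b. a \<in> C \<Longrightarrow> b \<in> C \<Longrightarrow> a \<le> b \<or> b \<le> a"
      unfolding Chains_def relation_of_def by blast+
    \<comment> \<open>Adding \<open>x\<close> keeps the join in the interval even for the empty
      chain.\<close>
    define D where "D = insert x C"
    have DA: "D \<subseteq> A"
      unfolding D_def using CA \<open>x \<in> A\<close> by blast
    have D_chain: "a \<le> b \<or> b \<le> a" if "a \<in> D" "b \<in> D" for a b
      using that chain CA unfolding D_def A_def by blast
    have "\<not> c \<le> Sup D"
    proof
      assume "c \<le> Sup D"
      then obtain F where "F \<subseteq> D" "finite F" "c \<le> Sup F"
        using c unfolding compact_element_def by blast
      moreover from this obtain w where "w \<in> D" "Sup F \<le> w"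
        using finite_chain_upper_bound [of F D] D_chain unfolding D_def by blast
      ultimately show False
        using DA order.trans unfolding A_def by blast
    qed
    moreover have "Sup D \<le> y"
      using DA unfolding A_def by (auto intro: Sup_least)
    moreover have "x \<le> Sup D"
      unfolding D_def by (simp add: Sup_upper)
    ultimately have "Sup D \<in> A"
      unfolding A_def by simp
    moreover have "\<forall>a\<in>C. a \<le> Sup D"
      unfolding D_def by (meson Sup_upper insertI2)
    ultimately show "\<exists>u\<in>A. \<forall>a\<in>C. a \<le> u"
      by blast
  qed
  then obtain u where u: "u \<in> A" and max: "\<And>a. a \<in> A \<Longrightarrow> u \<le> a \<Longrightarrow> a = u"
    by blast
  have "c \<le> t" if "u < t" "t \<le> y" for t
  proof (rule ccontr)
    assume "\<not> c \<le> t"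
    then have "t \<in> A"
      using that u unfolding A_def by auto
    then show False
      using that max [of t] by (simp add: order.strict_implies_order)
  qed
  then show thesis
    using that u unfolding A_def by blast
qed

lemma compact_separating:
  assumes "algebraic_lattice TYPE('a::complete_lattice)" and "\<not> (x :: 'a) \<le> y"
  obtains c where "compact_element c" "c \<le> x" "\<not> c \<le> y"
  using assms Sup_least [of "{c. compact_element c \<and> c \<le> x}" y]
  unfolding algebraic_lattice_def by (metis (mono_tags, lifting) mem_Collect_eq)

text \<open>Take a compact \<open>c\<close> below \<open>inf y z\<close> but not below
  \<open>x\<close>, and \<open>u\<close> maximal between \<open>x\<close> and \<open>sup x c\<close>
  among the elements not above \<open>c\<close>. Anything larger than \<open>u\<close> in this
  interval is above both \<open>x\<close> and \<open>c\<close>, so \<open>sup x c\<close> covers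
  \<open>u\<close>.\<close>

lemma meets_cover_determined_of_algebraic:
  assumes "algebraic_lattice TYPE('a::complete_lattice)"
  shows "meets_cover_determined TYPE('a)"
  unfolding meets_cover_determined_def
proof (intro allI impI)
  fix x y z :: 'a
  assume xyz: "x < y \<and> inf x z < inf y z"
  then have "\<not> inf y z \<le> x"
    by (metis inf_le2 le_inf_iff less_le_not_le)
  then obtain c where c: "compact_element c" "c \<le> y" "c \<le> z" "\<not> c \<le> x"
    using compact_separating [OF assms] by (metis le_inf_iff)
  obtain u where u: "x \<le> u" "u \<le> sup x c" "\<not> c \<le> u"
    and max: "\<And>t. u < t \<Longrightarrow> t \<le> sup x c \<Longrightarrow> c \<le> t"
    using maximal_not_above_compact [OF c(1) _ c(4), of "sup x c"] by auto
  have "u \<lessdot> sup x c"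
    unfolding covered_by_def
  proof
    show "u < sup x c"
      using u by (metis order.not_eq_order_implies_strict sup_ge2)
    show "\<not> (\<exists>t. u < t \<and> t < sup x c)"
    proof
      assume "\<exists>t. u < t \<and> t < sup x c"
      then obtain t where t: "u < t" "t < sup x c"
        by blast
      then have "c \<le> t"
        by (simp add: max)
      moreover have "x \<le> t"
        using u t by (meson order.trans order.strict_implies_order)
      ultimately show False
        using t by (metis le_sup_iff less_le_not_le)
    qed
  qed
  moreover have "inf u z < inf (sup x c) z"
  proof -
    have "inf u z \<le> inf (sup x c) z"
      using u by (simp add: le_infI1)
    moreover have "\<not> c \<le> inf u z" "c \<le> inf (sup x c) z"
      using u c by auto
    ultimately show ?thesis
      by (metis order.not_eq_order_implies_strict)
  qed
  moreover have "sup x c \<le> y"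
    using xyz c by (simp add: order.strict_implies_order)
  ultimately show "\<exists>u v. x \<le> u \<and> u \<lessdot> v \<and> v \<le> y \<and> inf u z < inf v z"
    using u by blast
qed

text \<open>An element \<open>m\<close> maximal among those not above a compact \<open>c\<close> is
  completely meet-irreducible, its upper cover being \<open>sup m c\<close>.\<close>

lemma Mic_separating_of_algebraic:
  assumes "algebraic_lattice TYPE('a::complete_lattice)" and "\<not> (x :: 'a) \<le> y"
  shows "\<exists>m\<in>Mic. y \<le> m \<and> \<not> x \<le> m"
proof -
  obtain c where c: "compact_element c" "c \<le> x" "\<not> c \<le> y"
    using compact_separating assms .
  obtain m where m: "y \<le> m" "\<not> c \<le> m" and max: "\<And>t. m < t \<Longrightarrow> c \<le> t"
    using maximal_not_above_compact [OF c(1) top_greatest c(3)] by auto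
  have "m < t \<longleftrightarrow> sup m c \<le> t" for t
    using max m(2) by (metis le_sup_iff less_le_not_le order.not_eq_order_implies_strict)
  then have "m \<in> Mic"
    unfolding Mic_iff by blast
  then show ?thesis
    using m c(2) order.trans by blast
qed

lemma bi_spatial_of_bi_algebraic:
  assumes "bi_algebraic TYPE('a::complete_lattice)"
  shows "bi_spatial TYPE('a)"
  unfolding bi_spatial_iff_separating
proof (intro allI impI conjI)
  fix x y :: 'a
  assume xy: "\<not> x \<le> y"
  have "\<exists>m\<in>Mic. dual x \<le> m \<and> \<not> dual y \<le> m"
    using assms xy unfolding bi_algebraic_def
    by (intro Mic_separating_of_algebraic algebraic_lattice_dual) auto
  then show "\<exists>j\<in>Jic. j \<le> x \<and> \<not> j \<le> y"
    by (metis dual_in_Mic_iff dual_undual less_eq_dual_iff)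
  show "\<exists>m\<in>Mic. y \<le> m \<and> \<not> x \<le> m"
    using assms xy unfolding bi_algebraic_def by (intro Mic_separating_of_algebraic) auto
qed

section \<open>Completely semidistributive lattices\<close>

text \<open>Complete join-semidistributivity puts the infimum \<open>j\<close> of all
  \<open>t\<close> with \<open>sup t u = v\<close> into that set. For \<open>t < j\<close> the join
  \<open>sup t u\<close> lies between \<open>u\<close> and \<open>v\<close> without being
  \<open>v\<close>, so it is \<open>u\<close>. Hence the elements strictly below \<open>j\<close>
  are those below \<open>inf j u\<close>.\<close>

lemma cover_label:
  assumes sd: "completely_join_semidistributive TYPE('a::complete_lattice)"
    and uv: "(u :: 'a) \<lessdot> v"
  shows "\<exists>j\<in>Jic. j \<le> v \<and> inf j u = lower_star j"
proof -
  let ?X = "{t. sup t u = v}"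
  let ?j = "Inf ?X"
  have "v \<in> ?X"
    using uv by (auto simp: covered_by_def sup.absorb1)
  then have j: "sup ?j u = v"
    using sd [unfolded completely_join_semidistributive_def, rule_format, of ?X u v] by blast
  then have "?j \<le> v"
    by (metis sup_ge1)
  have "\<not> ?j \<le> u"
    using j uv by (metis covered_by_def order.irrefl sup.absorb2)
  have star: "t < ?j \<longleftrightarrow> t \<le> inf ?j u" for t
  proof
    assume t: "t < ?j"
    then have "sup t u \<noteq> v"
      using Inf_lower [of t ?X] by auto
    moreover have "sup t u \<le> v"
      using t j by (metis order.strict_implies_order order.refl sup_mono)
    ultimately have "sup t u = u"
      using uv by (metis covered_by_def order.not_eq_order_implies_strict sup_ge2)
    then show "t \<le> inf ?j u"
      using t by (metis le_inf_iff order.strict_implies_order sup_ge1)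
  next
    assume "t \<le> inf ?j u"
    then show "t < ?j"
      using \<open>\<not> ?j \<le> u\<close> by (metis le_inf_iff order.not_eq_order_implies_strict)
  qed
  then have "?j \<in> Jic" "lower_star ?j = inf ?j u"
    using Jic_iff lower_star_eqI by blast+
  then show ?thesis
    using \<open>?j \<le> v\<close> by metis
qed

text \<open>The witness labels a cover between \<open>inf x y\<close> and \<open>x\<close>. It is
  not below \<open>u\<close>, whereas being below \<open>y\<close> would put it below
  \<open>inf x y\<close> and so below \<open>u\<close>.\<close>

lemma spatial_of_weakly_atomic:
  assumes sd: "completely_join_semidistributive TYPE('a::complete_lattice)"
    and wa: "weakly_atomic TYPE('a)" and xy: "\<not> (x :: 'a) \<le> y"
  shows "\<exists>j\<in>Jic. j \<le> x \<and> \<not> j \<le> y"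
proof -
  have "inf x y < x"
    using xy by (metis inf_le1 inf_le2 order.not_eq_order_implies_strict)
  then obtain u v where uv: "inf x y \<le> u" "u \<lessdot> v" "v \<le> x"
    using wa unfolding weakly_atomic_def by blast
  then obtain j where j: "j \<in> Jic" "j \<le> v" "inf j u = lower_star j"
    using cover_label [OF sd] by blast
  have "\<not> j \<le> u"
    using j lower_star_less by (metis inf.absorb1 order.irrefl)
  then show ?thesis
    using uv j by (meson le_inf_iff order.trans)
qed

lemma bi_spatial_of_weakly_atomic:
  assumes "completely_semidistributive TYPE('a::complete_lattice)" and "weakly_atomic TYPE('a)"
  shows "bi_spatial TYPE('a)"
  using assms unfolding completely_semidistributive_def
  by (intro bi_spatialI spatial_of_weakly_atomic completely_join_semidistributive_dual
      weakly_atomic_dual) auto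

section \<open>The map \<kappa> under complete semidistributivity\<close>

lemma kappa_exists:
  assumes sd: "completely_meet_semidistributive TYPE('a::complete_lattice)"
    and j: "(j :: 'a) \<in> Jic"
  shows "\<exists>q. is_maximum q {y. inf j y = lower_star j}"
proof -
  let ?Y = "{y. inf y j = lower_star j}"
  have "lower_star j \<in> ?Y"
    using lower_star_less [OF j] by (simp add: inf.absorb1)
  then have "inf (Sup ?Y) j = lower_star j"
    using sd [unfolded completely_meet_semidistributive_def, rule_format,
        of ?Y j "lower_star j"] by blast
  then have "is_maximum (Sup ?Y) {y. inf j y = lower_star j}"
    unfolding is_maximum_def by (auto simp: inf.commute intro: Sup_upper)
  then show ?thesis ..
qed

text \<open>By maximality of \<open>q\<close>, everything strictly above \<open>q\<close> is above
  \<open>j\<close>, so \<open>q\<close> has the upper cover \<open>sup q j\<close>. If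
  \<open>x\<close> has the same join with \<open>q\<close> as \<open>j\<close>, then so does
  \<open>inf j x\<close> by semidistributivity. Thus \<open>inf j x\<close> is not below
  \<open>q\<close>, hence not below \<open>lower_star j\<close>, which leaves only
  \<open>inf j x = j\<close>.\<close>

lemma kappa_inverse:
  assumes sd: "completely_join_semidistributive TYPE('a::complete_lattice)"
    and j: "(j :: 'a) \<in> Jic" and q: "is_maximum q {y. inf j y = lower_star j}"
  shows "q \<in> Mic" and "is_minimum j {x. sup q x = upper_star q}"
proof -
  have jq: "inf j q = lower_star j" and max: "\<And>y. inf j y = lower_star j \<Longrightarrow> y \<le> q"
    using q unfolding is_maximum_def by auto
  have "\<not> j \<le> q"
    using jq lower_star_less [OF j] by (metis inf.absorb1 order.irrefl)
  have star: "q < t \<longleftrightarrow> sup q j \<le> t" for t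
  proof
    assume t: "q < t"
    then have "inf j t \<noteq> lower_star j"
      using max by (metis less_le_not_le)
    moreover have "lower_star j \<le> inf j t"
      using jq t by (metis inf_mono order.refl order.strict_implies_order)
    ultimately have "\<not> inf j t < j"
      using less_Jic_iff [OF j] by (metis order.antisym)
    then show "sup q j \<le> t"
      using t by (metis inf_le1 inf_le2 le_sup_iff order.not_eq_order_implies_strict
          order.strict_implies_order)
  next
    assume "sup q j \<le> t"
    then show "q < t"
      using \<open>\<not> j \<le> q\<close> by (metis le_sup_iff order.not_eq_order_implies_strict)
  qed
  then show "q \<in> Mic"
    unfolding Mic_iff by blast
  have q_star: "upper_star q = sup q j"
    using star by (rule upper_star_eqI)
  have "j \<le> x" if x: "sup q x = sup q j" for x
  proof -
    have "sup (Inf {j, x}) q = sup q j"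
      using sd [unfolded completely_join_semidistributive_def, rule_format,
          of "{j, x}" q "sup q j"] x by (auto simp: sup.commute)
    then have "\<not> inf j x \<le> q"
      using \<open>\<not> j \<le> q\<close> by (metis Inf_insert Inf_empty inf_top_right sup.absorb2 sup_ge2)
    then have "\<not> inf j x < j"
      using less_Jic_iff [OF j] jq by (metis le_inf_iff)
    then show "j \<le> x"
      by (metis inf_le1 inf_le2 order.not_eq_order_implies_strict)
  qed
  then show "is_minimum j {x. sup q x = upper_star q}"
    unfolding is_minimum_def q_star by auto
qed

lemma kappa_maps_of_semidistributive:
  assumes "completely_semidistributive TYPE('a::complete_lattice)"
  shows "\<exists>k kd :: 'a \<Rightarrow> 'a. kappa_maps k kd"
proof -
  have jsd: "completely_join_semidistributive TYPE('a)"
    and msd: "completely_meet_semidistributive TYPE('a)"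
    using assms unfolding completely_semidistributive_def by auto
  have ex_kd: "\<exists>p. is_minimum p {x. sup m x = upper_star m}" if "m \<in> Mic" for m :: 'a
    using kappa_exists [OF completely_meet_semidistributive_dual [OF jsd], of "dual m"] that
    by (metis dual_in_Jic_iff dual_undual is_maximum_inf_dual_iff)
  have kd_inverse: "p \<in> Jic" "is_maximum m {y. inf p y = lower_star p}"
    if "m \<in> Mic" "is_minimum p {x. sup m x = upper_star m}" for m p :: 'a
    using kappa_inverse [OF completely_join_semidistributive_dual [OF msd], of "dual m" "dual p"]
      that
    by (simp_all add: dual_in_Jic_iff dual_in_Mic_iff is_maximum_inf_dual_iff
        is_minimum_sup_dual_iff)
  define k :: "'a \<Rightarrow> 'a" where "k j = (SOME q. is_maximum q {y. inf j y = lower_star j})" for j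
  define kd :: "'a \<Rightarrow> 'a" where "kd m = (SOME p. is_minimum p {x. sup m x = upper_star m})" for m
  have k: "is_maximum (k j) {y. inf j y = lower_star j}" if "j \<in> Jic" for j
    unfolding k_def using kappa_exists [OF msd that] by (rule someI_ex)
  have kd: "is_minimum (kd m) {x. sup m x = upper_star m}" if "m \<in> Mic" for m
    unfolding kd_def using ex_kd [OF that] by (rule someI_ex)
  have maps: "k ` Jic \<subseteq> Mic" "kd ` Mic \<subseteq> Jic"
    using kappa_inverse(1) [OF jsd] kd_inverse(1) k kd by blast+
  \<comment> \<open>By \<open>kappa_inverse\<close>, \<open>j\<close> is itself a minimum of the set
    defining \<open>kd (k j)\<close>, and minima are unique; dually for \<open>m\<close>.\<close>
  have inverse: "\<forall>j\<in>Jic. kd (k j) = j" "\<forall>m\<in>Mic. k (kd m) = m"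
    using is_minimum_unique [OF kd kappa_inverse(2) [OF jsd _ k]] kappa_inverse(1) [OF jsd _ k]
      is_maximum_unique [OF k kd_inverse(2) [OF _ kd]] kd_inverse(1) [OF _ kd] by auto
  have "kappa_maps k kd"
    unfolding kappa_maps_def
    using k kd inverse bij_betw_byWitness [OF inverse maps]
      bij_betw_byWitness [OF inverse(2,1) maps(2,1)] by blast
  then show ?thesis
    by blast
qed

text \<open>Cover-determination is applied to \<open>inf a b < a\<close> and the element
  \<open>b\<close>. Since \<open>v\<close> covers \<open>u\<close> and is not below
  \<open>sup u b\<close>, the meet of \<open>v\<close> with \<open>sup u b\<close> is
  \<open>u\<close>. So the label \<open>j\<close> of the cover meets \<open>sup u b\<close> in
  \<open>lower_star j\<close>, which gives \<open>b \<le> k j\<close>.\<close>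

lemma well_separated_of_joins_cover_determined:
  assumes sd: "completely_semidistributive TYPE('a::complete_lattice)"
    and jcd: "joins_cover_determined TYPE('a)"
  shows "well_separated_kappa_lattice TYPE('a)"
proof -
  obtain k kd :: "'a \<Rightarrow> 'a" where km: "kappa_maps k kd"
    using kappa_maps_of_semidistributive [OF sd] by blast
  have "\<exists>j\<in>Jic. j \<le> a \<and> b \<le> k j" if ab: "\<not> a \<le> b" for a b
  proof -
    have "inf a b < a"
      using ab by (metis inf_le1 inf_le2 order.not_eq_order_implies_strict)
    moreover have "sup (inf a b) b < sup a b"
      using ab by (simp add: sup.absorb2 less_le_not_le)
    ultimately obtain u v where uv: "u \<lessdot> v" "v \<le> a" "sup u b < sup v b"
      using jcd unfolding joins_cover_determined_def by blast
    have "inf v (sup u b) = u"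
    proof -
      have "u \<le> v" "inf v (sup u b) \<le> v" "u \<le> inf v (sup u b)"
        using uv unfolding covered_by_def by auto
      moreover have "\<not> v \<le> sup u b"
        using uv by (metis le_sup_iff less_le_not_le sup_ge2)
      ultimately show ?thesis
        using uv(1) unfolding covered_by_def
        by (metis inf_le2 order.not_eq_order_implies_strict)
    qed
    moreover obtain j where j: "j \<in> Jic" "j \<le> v" "inf j u = lower_star j"
      using cover_label [OF _ uv(1)] sd unfolding completely_semidistributive_def by blast
    ultimately have "inf j (sup u b) = lower_star j"
      by (metis inf.absorb1 inf.assoc)
    then have "sup u b \<le> k j"
      using le_kappa_iff [OF km j(1)] by blast
    then show ?thesis
      using j uv(2) by (meson le_sup_iff order.trans)
  qed
  moreover have "bi_spatial TYPE('a)"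
    using sd jcd by (intro bi_spatial_of_weakly_atomic weakly_atomic_of_joins_cover_determined)
  ultimately show ?thesis
    unfolding well_separated_kappa_lattice_def using km by blast
qed

text \<open>The type \<open>'b\<close> admits factorization systems on a carrier type unrelated to
  the lattice. The representations that are constructed live on the lattice itself.\<close>

theorem theorem3p1:
  shows "(two_acyclic_Pairs_rep TYPE('a::complete_lattice) TYPE('a) \<longleftrightarrow>
            well_separated_kappa_lattice TYPE('a)) \<and>
    (two_acyclic_Pairs_rep TYPE('a) TYPE('b) \<longrightarrow> well_separated_kappa_lattice TYPE('a)) \<and>
    (well_separated_kappa_lattice TYPE('a) \<longrightarrow> kappa_lattice TYPE('a)) \<and>
    (two_acyclic_Pairs_rep TYPE('a) TYPE('b) \<longrightarrow>
            joins_cover_determined TYPE('a) \<and> meets_cover_determined TYPE('a)) \<and>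
    (joins_cover_determined TYPE('a) \<and> meets_cover_determined TYPE('a) \<longrightarrow>
            weakly_atomic TYPE('a)) \<and>
    (kappa_lattice TYPE('a) \<longrightarrow> bi_spatial TYPE('a)) \<and>
    (bi_algebraic TYPE('a) \<longrightarrow>
            joins_cover_determined TYPE('a) \<and> meets_cover_determined TYPE('a)) \<and>
    (bi_algebraic TYPE('a) \<longrightarrow> bi_spatial TYPE('a)) \<and>
    (completely_semidistributive TYPE('a) \<longrightarrow>
      (joins_cover_determined TYPE('a) \<and> meets_cover_determined TYPE('a) \<longrightarrow>
            two_acyclic_Pairs_rep TYPE('a) TYPE('a)) \<and>
      (weakly_atomic TYPE('a) \<longrightarrow> bi_spatial TYPE('a)) \<and>
      (bi_spatial TYPE('a) \<longrightarrow> kappa_lattice TYPE('a)))"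
  using well_separated_of_Pairs_rep [where ?'a = 'a and ?'b = 'a]
    well_separated_of_Pairs_rep [where ?'a = 'a and ?'b = 'b]
    Pairs_rep_of_well_separated [where ?'a = 'a]
    cover_determined_of_well_separated [where ?'a = 'a]
    weakly_atomic_of_joins_cover_determined [where ?'a = 'a]
    meets_cover_determined_of_algebraic [where ?'a = 'a]
    joins_cover_determined_of_dual [OF meets_cover_determined_of_algebraic
      [OF algebraic_lattice_dual [where ?'a = 'a]]]
    bi_spatial_of_bi_algebraic [where ?'a = 'a]
    well_separated_of_joins_cover_determined [where ?'a = 'a]
    bi_spatial_of_weakly_atomic [where ?'a = 'a]
    kappa_maps_of_semidistributive [where ?'a = 'a]
  unfolding bi_algebraic_def kappa_lattice_def well_separated_kappa_lattice_def by blast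

end
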